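(* Let $A\in\mathbb{R}^{n\times n}$, and let $\mathcal{P}=\{x\in\mathbb{R}^n : Gx\le b\}$ be a polyhedron, where $G\in\mathbb{R}^{m\times n}$ and $b\in\mathbb{R}^m$. Assume that $\mathcal{P}$ is an invariant set for the continuous system $\dot{x}(t)=Ax(t)$, and let $x_k\in\mathcal{P}$. Then there exists $\tau(x_k)>0$ such that $x_{k+1}\in\mathcal{P}$ for all $\Delta t\in[0,\tau(x_k)]$, where $x_{k+1}=(I-\Delta t A)^{-1}x_k$ is obtained by the backward Euler method.
   Context: The inequality $Gx\le b$ is componentwise. A set $\mathcal{S}$ is an invariant set for $\dot x(t)=Ax(t)$ if $x(0)\in\mathcal{S}$ implies $x(t)\in\mathcal{S}$ for all $t\ge0$. A statement about $x_{k+1}=(I-\Delta t A)^{-1}x_k$ is understood to include that $I-\Delta t A$ is nonsingular. *)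

theory Defs
  imports "HOL-Analysis.Analysis"
begin

text \<open>Differentiability is required only along \<open>[0, \<infinity>)\<close>, so the derivative at \<open>t = 0\<close> is one-sided.\<close>

definition solves_linear_ode :: "real ^ 'n ^ 'n \<Rightarrow> (real \<Rightarrow> real ^ 'n) \<Rightarrow> bool" where
  "solves_linear_ode A x \<longleftrightarrow>
     (\<forall>t\<ge>0. (x has_vector_derivative A *v x t) (at t within {0..}))"

definition invariant_set_linear_ode :: "real ^ 'n ^ 'n \<Rightarrow> (real ^ 'n) set \<Rightarrow> bool" where
  "invariant_set_linear_ode A S \<longleftrightarrow>
     (\<forall>x. solves_linear_ode A x \<longrightarrow> x 0 \<in> S \<longrightarrow> (\<forall>t\<ge>0. x t \<in> S))"

text \<open>The value is meaningful only when \<open>I - h A\<close> is invertible, because \<^const>\<open>matrix_inv\<close> is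
  unspecified on singular matrices.\<close>

definition backward_euler_step :: "real ^ 'n ^ 'n \<Rightarrow> real \<Rightarrow> real ^ 'n \<Rightarrow> real ^ 'n" where
  "backward_euler_step A h x = matrix_inv (mat 1 - h *\<^sub>R A) *v x"

text \<open>The order on \<^typ>\<open>real ^ 'm\<close> is the componentwise one.\<close>

definition polyhedron_of :: "real ^ 'n ^ 'm \<Rightarrow> real ^ 'm \<Rightarrow> (real ^ 'n) set" where
  "polyhedron_of G b = {x. G *v x \<le> b}"

end

theory Submission
  imports Defs
begin

text \<open>
  Both the exact flow and the backward Euler step are power series in the step length whose
  coefficients come from the same vectors \<open>A\<^sup>j x\<close>: the flow is
  \<open>\<Sum>j. (t\<^sup>j / j!) A\<^sup>j x\<close> and, for small \<open>h\<close>, the Neumann series gives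
  \<open>(I - h A)\<^sup>-\<^sup>1 x = \<Sum>j. h\<^sup>j A\<^sup>j x\<close>.

  For a row \<open>g\<close> of \<open>G\<close> with bound \<open>\<beta>\<close>, the excess \<open>g \<bullet> y - \<beta>\<close> along either curve is thus a power
  series in one real variable, and the two coefficient sequences agree up to the positive
  factors \<open>1 / j!\<close>. The sign of a power series just to the right of \<open>0\<close> is the sign of its first
  nonzero coefficient (lemma \<open>powser_pos_at_right_0\<close>). Invariance says that the excess along the
  flow is never positive, so the first nonzero coefficient, if there is one, is negative; then
  the excess along the backward Euler curve is also nonpositive for all small \<open>h > 0\<close>
  (lemma \<open>powser_nonpos_at_right_0_transfer\<close>). There are finitely many rows, so one threshold
  serves them all. It depends on \<open>x\<close> because the index of the first nonzero coefficient and the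
  size of the later ones do.
\<close>

section \<open>The sign of a power series to the right of the origin\<close>

text \<open>Dividing by \<open>t\<^sup>k\<close> leaves a power series that is continuous at \<open>0\<close> with the positive value
  \<open>a k\<close> there.\<close>

lemma powser_pos_at_right_0:
  fixes a :: "nat \<Rightarrow> real"
  assumes r: "0 < r" and sm: "\<And>t. \<bar>t\<bar> < r \<Longrightarrow> summable (\<lambda>j. a j * t ^ j)"
    and zero: "\<And>j. j < k \<Longrightarrow> a j = 0" and pos: "0 < a k"
  shows "\<forall>\<^sub>F t in at_right 0. 0 < (\<Sum>j. a j * t ^ j)"
proof -
  define f where "f t = (\<Sum>j. a (j + k) * t ^ j)" for t
  have sm_f: "summable (\<lambda>j. a (j + k) * t ^ j)" if "\<bar>t\<bar> < r" for t
  proof (cases "t = 0")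
    case True
    then show ?thesis
      by (simp add: summable_0_powser)
  next
    case False
    have "summable (\<lambda>j. a (j + k) * t ^ (j + k) * inverse (t ^ k))"
      using summable_ignore_initial_segment[OF sm[OF that], of k] by (rule summable_mult2)
    moreover have "a (j + k) * t ^ (j + k) * inverse (t ^ k) = a (j + k) * t ^ j" for j
      using False by (simp add: power_add field_simps)
    ultimately show ?thesis by simp
  qed
  have "(f \<longlongrightarrow> a k) (at 0)"
    using powser_limit_0_strong[of r "\<lambda>j. a (j + k)" f] r sm_f
    by (simp add: f_def summable_sums)
  then have "(f \<longlongrightarrow> a k) (at_right 0)"
    by (rule filterlim_mono) (auto intro: at_le)
  then have "\<forall>\<^sub>F t in at_right 0. 0 < f t"
    using pos by (rule order_tendstoD)
  moreover have "\<forall>\<^sub>F t in at_right 0. t \<in> {0<..<r}"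
    using r by (rule eventually_at_right_real)
  ultimately show ?thesis
  proof eventually_elim
    case (elim t)
    have "(\<Sum>j. a j * t ^ j) = (\<Sum>j. a (j + k) * t ^ (j + k))"
      using suminf_split_initial_segment[OF sm[of t], of k] elim zero by simp
    also have "\<dots> = (\<Sum>j. t ^ k * (a (j + k) * t ^ j))"
      by (simp add: power_add mult_ac)
    also have "\<dots> = t ^ k * f t"
      unfolding f_def using elim by (intro suminf_mult sm_f) auto
    finally show ?case using elim by simp
  qed
qed

text \<open>Positive weights do not change the index or the sign of the first nonzero coefficient, and
  nonpositivity of the weighted series rules out the positive sign.\<close>

lemma powser_nonpos_at_right_0_transfer:
  fixes a w :: "nat \<Rightarrow> real"
  assumes r: "0 < r" and sm: "\<And>t. \<bar>t\<bar> < r \<Longrightarrow> summable (\<lambda>j. a j * t ^ j)"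
    and w: "\<And>j. 0 < w j"
    and sm_w: "\<And>t. \<bar>t\<bar> < r \<Longrightarrow> summable (\<lambda>j. w j * a j * t ^ j)"
    and nonpos: "\<And>t. 0 < t \<Longrightarrow> (\<Sum>j. w j * a j * t ^ j) \<le> 0"
  shows "\<forall>\<^sub>F t in at_right 0. (\<Sum>j. a j * t ^ j) \<le> 0"
proof (cases "\<forall>j. a j = 0")
  case True
  then show ?thesis by simp
next
  case False
  define k where "k = (LEAST j. a j \<noteq> 0)"
  have below: "a j = 0" if "j < k" for j
    using that not_less_Least[of j "\<lambda>j. a j \<noteq> 0"] by (auto simp: k_def)
  have k: "a k \<noteq> 0"
    using False LeastI_ex[of "\<lambda>j. a j \<noteq> 0"] by (auto simp: k_def)
  have "\<not> 0 < a k"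
  proof
    assume "0 < a k"
    then have "\<forall>\<^sub>F t in at_right 0. 0 < (\<Sum>j. w j * a j * t ^ j)"
      using r sm_w w below by (intro powser_pos_at_right_0[where k = k and r = r]) auto
    moreover have "\<forall>\<^sub>F t in at_right (0::real). 0 < t"
      by (rule eventually_at_right_less)
    ultimately have "\<forall>\<^sub>F t in at_right (0::real). False"
      by eventually_elim (use nonpos in force)
    then show False by simp
  qed
  then have "0 < - a k"
    using k by simp
  then have "\<forall>\<^sub>F t in at_right 0. 0 < (\<Sum>j. - a j * t ^ j)"
    using r below summable_minus[OF sm]
    by (intro powser_pos_at_right_0[where k = k and r = r]) auto
  moreover have "\<forall>\<^sub>F t in at_right 0. t \<in> {0<..<r}"
    using r by (rule eventually_at_right_real)
  ultimately show ?thesis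
    by eventually_elim (use suminf_minus[OF sm] in auto)
qed

section \<open>The exponential and Neumann series of a matrix applied to a vector\<close>

lemma norm_matrix_power_vec_le:
  fixes A :: "real ^ 'n ^ 'n"
  assumes K: "\<And>v. norm (A *v v) \<le> norm v * K" and "0 \<le> K"
  shows "norm (((*v) A ^^ j) x) \<le> K ^ j * norm x"
proof (induction j)
  case (Suc j)
  have "norm (((*v) A ^^ Suc j) x) \<le> norm (((*v) A ^^ j) x) * K"
    using K by simp
  also have "\<dots> \<le> K ^ j * norm x * K"
    using Suc \<open>0 \<le> K\<close> by (rule mult_right_mono)
  finally show ?case by (simp add: mult_ac)
qed simp

lemma summable_matrix_exp_vec:
  fixes A :: "real ^ 'n ^ 'n"
  shows "summable (\<lambda>j. (t ^ j / fact j) *\<^sub>R ((*v) A ^^ j) x)"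
proof -
  obtain K where K: "0 < K" "\<And>v. norm (A *v v) \<le> norm v * K"
    using bounded_linear.pos_bounded[OF matrix_vector_mul_bounded_linear] by blast
  have "norm ((t ^ j / fact j) *\<^sub>R ((*v) A ^^ j) x) \<le> inverse (fact j) * (\<bar>t\<bar> * K) ^ j * norm x" for j
  proof -
    have "norm ((t ^ j / fact j) *\<^sub>R ((*v) A ^^ j) x) = \<bar>t\<bar> ^ j / fact j * norm (((*v) A ^^ j) x)"
      by (simp add: power_abs)
    also have "\<dots> \<le> \<bar>t\<bar> ^ j / fact j * (K ^ j * norm x)"
      using norm_matrix_power_vec_le[OF K(2)] K(1) by (intro mult_left_mono) auto
    finally show ?thesis
      by (simp add: power_mult_distrib divide_inverse mult_ac)
  qed
  then show ?thesis
    by (intro summable_comparison_test'[OF summable_mult2[OF summable_exp]])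
qed

lemma summable_matrix_neumann_vec:
  fixes A :: "real ^ 'n ^ 'n"
  assumes K: "\<And>v. norm (A *v v) \<le> norm v * K" and "0 \<le> K" and h: "\<bar>h\<bar> * K < 1"
  shows "summable (\<lambda>j. h ^ j *\<^sub>R ((*v) A ^^ j) x)"
proof -
  have "norm (h ^ j *\<^sub>R ((*v) A ^^ j) x) \<le> (\<bar>h\<bar> * K) ^ j * norm x" for j
  proof -
    have "\<bar>h\<bar> ^ j * norm (((*v) A ^^ j) x) \<le> \<bar>h\<bar> ^ j * (K ^ j * norm x)"
      using norm_matrix_power_vec_le[OF K] \<open>0 \<le> K\<close> by (intro mult_left_mono) auto
    then show ?thesis
      by (simp add: power_abs power_mult_distrib mult_ac)
  qed
  moreover have "summable (\<lambda>j. (\<bar>h\<bar> * K) ^ j * norm x)"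
    using h \<open>0 \<le> K\<close> by (intro summable_mult2 summable_geometric) simp
  ultimately show ?thesis
    by (rule summable_comparison_test'[rotated])
qed

text \<open>Against each basis vector the series is a scalar power series convergent on the whole line,
  so it can be differentiated termwise; this shifts the coefficients by one index, which is
  multiplication by \<open>A\<close>.\<close>

lemma matrix_exp_series_solves_linear_ode:
  fixes A :: "real ^ 'n ^ 'n"
  shows "solves_linear_ode A (\<lambda>t. \<Sum>j. (t ^ j / fact j) *\<^sub>R ((*v) A ^^ j) x)"
proof -
  define y where "y t = (\<Sum>j. (t ^ j / fact j) *\<^sub>R ((*v) A ^^ j) x)" for t
  have y_inner: "y t \<bullet> u = (\<Sum>j. ((*v) A ^^ j) x \<bullet> u / fact j * t ^ j)"
    and y_inner_summable: "summable (\<lambda>j. ((*v) A ^^ j) x \<bullet> u / fact j * t ^ j)" for t u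
    using bounded_linear.suminf[OF bounded_linear_inner_left[of u] summable_matrix_exp_vec[of t A x]]
      bounded_linear.summable[OF bounded_linear_inner_left[of u] summable_matrix_exp_vec[of t A x]]
    by (simp_all add: y_def mult_ac)
  have Ay: "A *v y t = (\<Sum>j. (t ^ j / fact j) *\<^sub>R ((*v) A ^^ Suc j) x)"
    and Ay_summable: "summable (\<lambda>j. (t ^ j / fact j) *\<^sub>R ((*v) A ^^ Suc j) x)" for t
    using bounded_linear.suminf[OF matrix_vector_mul_bounded_linear[of A] summable_matrix_exp_vec[of t A x]]
      bounded_linear.summable[OF matrix_vector_mul_bounded_linear[of A] summable_matrix_exp_vec[of t A x]]
    by (simp_all add: y_def matrix_vector_mult_scaleR)
  have Ay_inner: "(A *v y t) \<bullet> u = (\<Sum>j. ((*v) A ^^ Suc j) x \<bullet> u / fact j * t ^ j)" for t u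
    using bounded_linear.suminf[OF bounded_linear_inner_left[of u] Ay_summable[of t]]
    by (simp add: Ay mult_ac)
  have deriv: "((\<lambda>t. y t \<bullet> u) has_field_derivative (A *v y t) \<bullet> u) (at t)" for t u
  proof -
    have "diffs (\<lambda>j. ((*v) A ^^ j) x \<bullet> u / fact j) = (\<lambda>j. ((*v) A ^^ Suc j) x \<bullet> u / fact j)"
      by (simp add: diffs_def fun_eq_iff field_simps del: of_nat_Suc)
    then show ?thesis
      using termdiffs_strong_converges_everywhere[OF y_inner_summable[of u], of t]
      by (simp add: y_inner Ay_inner)
  qed
  have "(y has_vector_derivative A *v y t) (at t within {0..})" for t
    unfolding has_vector_derivative_def
  proof (subst has_derivative_componentwise_within, intro ballI)
    fix u :: "real ^ 'n"
    show "((\<lambda>t. y t \<bullet> u) has_derivative (\<lambda>s. (s *\<^sub>R (A *v y t)) \<bullet> u)) (at t within {0..})"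
      using has_field_derivative_at_within[OF deriv[of u t]]
      by (simp add: has_field_derivative_def mult_commute_abs)
  qed
  then show ?thesis
    by (simp add: solves_linear_ode_def y_def[abs_def])
qed

lemma matrix_inv_mult_left:
  fixes M :: "real ^ 'n ^ 'n"
  assumes "invertible M"
  shows "matrix_inv M ** M = mat 1"
  using someI_ex[OF assms[unfolded invertible_def]] unfolding matrix_inv_def by blast

lemma invertible_mat_1_minus_scaleR:
  fixes A :: "real ^ 'n ^ 'n"
  assumes K: "\<And>v. norm (A *v v) \<le> norm v * K" and h: "\<bar>h\<bar> * K < 1"
  shows "invertible (mat 1 - h *\<^sub>R A)"
proof -
  have "v = 0" if "(mat 1 - h *\<^sub>R A) *v v = 0" for v
  proof (rule ccontr)
    assume "v \<noteq> 0"
    have "v = h *\<^sub>R (A *v v)"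
      using that by (simp add: matrix_vector_mult_diff_rdistrib scaleR_matrix_vector_assoc)
    then have "norm v = \<bar>h\<bar> * norm (A *v v)"
      by (metis norm_scaleR)
    also have "\<dots> \<le> \<bar>h\<bar> * (norm v * K)"
      using K by (intro mult_left_mono) auto
    also have "\<dots> < norm v"
      using mult_strict_right_mono[OF h, of "norm v"] \<open>v \<noteq> 0\<close> by (simp add: mult_ac)
    finally show False by simp
  qed
  then show ?thesis
    by (simp add: invertible_left_inverse matrix_left_invertible_ker)
qed

text \<open>Applying \<open>I - h A\<close> to the Neumann series telescopes it to its first term.\<close>

lemma backward_euler_step_eq_neumann_series:
  fixes A :: "real ^ 'n ^ 'n"
  assumes K: "\<And>v. norm (A *v v) \<le> norm v * K" and "0 \<le> K" and h: "\<bar>h\<bar> * K < 1"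
  shows "backward_euler_step A h x = (\<Sum>j. h ^ j *\<^sub>R ((*v) A ^^ j) x)" (is "_ = ?y")
proof -
  let ?M = "mat 1 - h *\<^sub>R A"
  note sm = summable_matrix_neumann_vec[OF assms, of x]
  have "h *\<^sub>R (A *v ?y) = (\<Sum>j. h ^ Suc j *\<^sub>R ((*v) A ^^ Suc j) x)"
    using bounded_linear.suminf[OF matrix_vector_mul_bounded_linear[of A] sm]
      suminf_scaleR_right[OF bounded_linear.summable[OF matrix_vector_mul_bounded_linear[of A] sm], of h]
    by (simp add: matrix_vector_mult_scaleR)
  also have "\<dots> = ?y - x"
    using suminf_split_head[OF sm] by simp
  finally have My: "?M *v ?y = x"
    by (simp add: matrix_vector_mult_diff_rdistrib scaleR_matrix_vector_assoc)
  have "?y = (matrix_inv ?M ** ?M) *v ?y"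
    by (simp only: matrix_inv_mult_left[OF invertible_mat_1_minus_scaleR[OF K h]] matrix_vector_mul_lid)
  also have "\<dots> = matrix_inv ?M *v (?M *v ?y)"
    by (simp only: matrix_vector_mul_assoc)
  also have "\<dots> = backward_euler_step A h x"
    by (simp only: My backward_euler_step_def)
  finally show ?thesis ..
qed

section \<open>Local invariance under the backward Euler method\<close>

text \<open>Comparison of the flow with the backward Euler curve for a single constraint. The bound \<open>\<beta>\<close>
  is absorbed into the coefficient of index \<open>0\<close>, where the two series have the same weight because \<open>0! = 1\<close>.\<close>

lemma backward_euler_half_space:
  fixes A :: "real ^ 'n ^ 'n"
  assumes flow: "\<And>t. 0 < t \<Longrightarrow> g \<bullet> (\<Sum>j. (t ^ j / fact j) *\<^sub>R ((*v) A ^^ j) x) \<le> \<beta>"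
  shows "\<forall>\<^sub>F h in at_right 0. g \<bullet> backward_euler_step A h x \<le> \<beta>"
proof -
  obtain K where K: "0 < K" "\<And>v. norm (A *v v) \<le> norm v * K"
    using bounded_linear.pos_bounded[OF matrix_vector_mul_bounded_linear] by blast
  have small: "\<bar>h\<bar> * K < 1" if "\<bar>h\<bar> < 1 / K" for h
    using that K(1) by (simp add: field_simps)
  define a where "a j = g \<bullet> ((*v) A ^^ j) x - (if j = 0 then \<beta> else 0)" for j
  have const: "(\<lambda>j. if j = 0 then \<beta> else 0) sums \<beta>"
    using sums_single[of 0 "\<lambda>_. \<beta>"] by (simp add: eq_commute)
  have exp_sums: "(\<lambda>j. inverse (fact j) * a j * t ^ j) sums
      (g \<bullet> (\<Sum>j. (t ^ j / fact j) *\<^sub>R ((*v) A ^^ j) x) - \<beta>)" for t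
  proof -
    have "(\<lambda>j. g \<bullet> ((t ^ j / fact j) *\<^sub>R ((*v) A ^^ j) x) - (if j = 0 then \<beta> else 0)) sums
      (g \<bullet> (\<Sum>j. (t ^ j / fact j) *\<^sub>R ((*v) A ^^ j) x) - \<beta>)"
      by (intro sums_diff const bounded_linear.sums[OF bounded_linear_inner_right]
          summable_sums summable_matrix_exp_vec)
    then show ?thesis
      by (rule iffD1[OF sums_cong, rotated]) (auto simp: a_def field_simps)
  qed
  have neumann_sums: "(\<lambda>j. a j * h ^ j) sums (g \<bullet> backward_euler_step A h x - \<beta>)"
    if "\<bar>h\<bar> < 1 / K" for h
  proof -
    note hK = small[OF that]
    have "(\<lambda>j. g \<bullet> (h ^ j *\<^sub>R ((*v) A ^^ j) x) - (if j = 0 then \<beta> else 0)) sums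
      (g \<bullet> backward_euler_step A h x - \<beta>)"
      unfolding backward_euler_step_eq_neumann_series[OF K(2) less_imp_le[OF K(1)] hK]
      by (intro sums_diff const bounded_linear.sums[OF bounded_linear_inner_right]
          summable_sums summable_matrix_neumann_vec[OF K(2) less_imp_le[OF K(1)] hK])
    then show ?thesis
      by (rule iffD1[OF sums_cong, rotated]) (auto simp: a_def field_simps)
  qed
  have "\<forall>\<^sub>F h in at_right 0. (\<Sum>j. a j * h ^ j) \<le> 0"
  proof (rule powser_nonpos_at_right_0_transfer)
    show "0 < 1 / K" using K(1) by simp
    show "summable (\<lambda>j. a j * t ^ j)" if "\<bar>t\<bar> < 1 / K" for t
      using neumann_sums[OF that] by (rule sums_summable)
    show "(0::real) < inverse (fact j)" for j by simp
    show "summable (\<lambda>j. inverse (fact j) * a j * t ^ j)" for t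
      using exp_sums by (rule sums_summable)
    show "(\<Sum>j. inverse (fact j) * a j * t ^ j) \<le> 0" if "0 < t" for t
      using flow[OF that] sums_unique[OF exp_sums[of t]] by simp
  qed
  moreover have "\<forall>\<^sub>F h in at_right 0. h \<in> {0<..<1 / K}"
    using K(1) by (intro eventually_at_right_real) simp
  ultimately show ?thesis
  proof eventually_elim
    case (elim h)
    then have "\<bar>h\<bar> < 1 / K"
      by simp
    then show ?case
      using elim(1) sums_unique[OF neumann_sums[of h]] by linarith
  qed
qed

theorem lemma3p2:
  fixes A :: "real ^ 'n ^ 'n" and G :: "real ^ 'n ^ 'm" and b :: "real ^ 'm"
    and xk :: "real ^ 'n"
  assumes "invariant_set_linear_ode A (polyhedron_of G b)"
    and "xk \<in> polyhedron_of G b"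
  shows "\<exists>\<tau>>0. \<forall>\<Delta>t\<in>{0..\<tau>}. invertible (mat 1 - \<Delta>t *\<^sub>R A) \<and>
           backward_euler_step A \<Delta>t xk \<in> polyhedron_of G b"
proof -
  obtain K where K: "0 < K" "\<And>v. norm (A *v v) \<le> norm v * K"
    using bounded_linear.pos_bounded[OF matrix_vector_mul_bounded_linear] by blast
  define y where "y t = (\<Sum>j. (t ^ j / fact j) *\<^sub>R ((*v) A ^^ j) xk)" for t
  have mem: "v \<in> polyhedron_of G b \<longleftrightarrow> (\<forall>i. G $ i \<bullet> v \<le> b $ i)" for v
    by (simp add: polyhedron_of_def less_eq_vec_def matrix_vector_mul_component)
  have "y 0 = xk"
    using suminf_split_head[OF summable_matrix_exp_vec[of 0 A xk]]
    by (simp add: y_def)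
  then have inv: "y t \<in> polyhedron_of G b" if "0 \<le> t" for t
    using assms that matrix_exp_series_solves_linear_ode[of A xk]
    unfolding invariant_set_linear_ode_def y_def[abs_def, symmetric] by simp
  have "\<forall>\<^sub>F h in at_right 0. G $ i \<bullet> backward_euler_step A h xk \<le> b $ i" for i
    using inv mem by (intro backward_euler_half_space) (simp add: y_def)
  then have "\<forall>\<^sub>F h in at_right 0. \<forall>i. G $ i \<bullet> backward_euler_step A h xk \<le> b $ i"
    by (rule eventually_all_finite)
  moreover have "\<forall>\<^sub>F h in at_right 0. h \<in> {0<..<1 / K}"
    using K(1) by (intro eventually_at_right_real) simp
  ultimately have "\<forall>\<^sub>F h in at_right 0. invertible (mat 1 - h *\<^sub>R A) \<and>
      backward_euler_step A h xk \<in> polyhedron_of G b"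
  proof eventually_elim
    case (elim h)
    then have "\<bar>h\<bar> * K < 1"
      using K(1) by (simp add: field_simps)
    then show ?case
      using elim invertible_mat_1_minus_scaleR[OF K(2)] mem by blast
  qed
  then obtain \<delta> where \<delta>: "0 < \<delta>" "\<And>h. 0 < h \<Longrightarrow> h < \<delta> \<Longrightarrow> invertible (mat 1 - h *\<^sub>R A) \<and>
      backward_euler_step A h xk \<in> polyhedron_of G b"
    unfolding eventually_at_right_field by auto
  \<comment> \<open>The step \<open>h = 0\<close> is outside the reach of the one-sided filter and is the identity.\<close>
  have "backward_euler_step A 0 xk = xk"
    using matrix_inv_mult_left[OF invertible_mat_1_minus_scaleR[OF K(2), of 0]]
    by (simp add: backward_euler_step_def)
  then have "invertible (mat 1 - h *\<^sub>R A) \<and> backward_euler_step A h xk \<in> polyhedron_of G b"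
    if "h \<in> {0..\<delta> / 2}" for h
    using that \<delta> assms(2) invertible_mat_1_minus_scaleR[OF K(2), of 0]
    by (cases "h = 0") auto
  then show ?thesis
    using \<delta>(1) by (intro exI[of _ "\<delta> / 2"]) simp
qed

end
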